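(* Let $\xi\in H$, $\xi\neq 0$, let $U$ be a unitary operator on $H$, and let $T=\begin{bmatrix} UA & U(\xi)\\ \langle\cdot,\xi\rangle & a\end{bmatrix}\in G$, where $a=\sqrt{1+\|\xi\|^2}$ and $A$ is the positive operator on $H$ with $A(\xi)=a\xi$ and $A=I$ on $\langle\xi\rangle^{\perp}$. Then $T=T_1\oplus T_2$ with respect to the orthogonal decomposition $H\oplus\mathbb{C}=(\langle\xi\rangle\oplus\mathbb{C})\oplus\langle\xi\rangle^{\perp}$, where $T_1=T\restriction_{\langle\xi\rangle\oplus\mathbb{C}}$ and $T_2=U\restriction_{\langle\xi\rangle^{\perp}}$, if and only if $U(\xi)=r\xi$ for some $r\in\mathbb{C}$ with $|r|=1$.
   Context: $H$ is an infinite-dimensional complex Hilbert space with inner product $\langle\cdot,\cdot\rangle$ linear in the first variable. On $H\oplus\mathbb{C}$ consider the sesquilinear form $\mathcal{A}((x,\lambda),(y,\mu))=\langle x,y\rangle-\lambda\overline{\mu}$. $G$ is the group of all bijective linear operators on $H\oplus\mathbb{C}$ leaving $\mathcal{A}$ invariant. A block matrix $\begin{bmatrix} P & \eta\\ \langle\cdot,\zeta\rangle & c\end{bmatrix}$ denotes the operator $(x,z)\mapsto (P(x)+z\eta,\ \langle x,\zeta\rangle+cz)$ on $H\oplus\mathbb{C}$. $\langle\xi\rangle$ denotes the linear span of $\xi$, and $\langle\xi\rangle^{\perp}$ its orthogonal complement in $H$, identified with $\langle\xi\rangle^{\perp}\oplus 0=(\langle\xi\rangle\oplus\mathbb{C})^{\perp}$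 in $H\oplus\mathbb{C}$. Writing $T=T_1\oplus T_2$ means that both summands are invariant under $T$ and that $T$ restricts to $T_1$ and $T_2$ on them. *)

theory Defs
  imports "HOL-Analysis.Analysis"
begin

class complex_vector = real_vector +
  fixes scaleC :: "complex \<Rightarrow> 'a \<Rightarrow> 'a"  (infixr \<open>*\<^sub>C\<close> 75)
  assumes scaleC_add_right: "c *\<^sub>C (x + y) = c *\<^sub>C x + c *\<^sub>C y"
    and scaleC_add_left: "(c + d) *\<^sub>C x = c *\<^sub>C x + d *\<^sub>C x"
    and scaleC_scaleC: "c *\<^sub>C d *\<^sub>C x = (c * d) *\<^sub>C x"
    and scaleC_one: "1 *\<^sub>C x = x"
    and scaleR_eq_scaleC: "r *\<^sub>R x = complex_of_real r *\<^sub>C x"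

global_interpretation complex_vector:
  vector_space "scaleC :: complex \<Rightarrow> 'a \<Rightarrow> 'a::complex_vector"
  defines cspan = complex_vector.span
    and csubspace = complex_vector.subspace
  by unfold_locales
    (simp_all add: scaleC_add_right scaleC_add_left scaleC_scaleC scaleC_one)

abbreviation clinear :: "('a::complex_vector \<Rightarrow> 'b::complex_vector) \<Rightarrow> bool"
  where "clinear \<equiv> Vector_Spaces.linear scaleC scaleC"

text \<open>The inner product is linear in the first variable.\<close>

class complex_inner = complex_vector + real_normed_vector +
  fixes cinner :: "'a \<Rightarrow> 'a \<Rightarrow> complex"
  assumes cinner_commute: "cinner x y = cnj (cinner y x)"
    and cinner_add_left: "cinner (x + y) z = cinner x z + cinner y z"
    and cinner_scaleC_left: "cinner (c *\<^sub>C x) y = c * cinner x y"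
    and cinner_ge_zero: "0 \<le> Re (cinner x x)"
    and cinner_eq_zero_iff: "cinner x x = 0 \<longleftrightarrow> x = 0"
    and norm_eq_sqrt_cinner: "norm x = sqrt (Re (cinner x x))"

class complex_hilbert = complex_inner + complete_space

instantiation complex :: complex_hilbert
begin

definition scaleC_complex :: "complex \<Rightarrow> complex \<Rightarrow> complex"
  where "scaleC_complex c z = c * z"

definition cinner_complex :: "complex \<Rightarrow> complex \<Rightarrow> complex"
  where "cinner_complex z w = z * cnj w"

instance
  by intro_classes
    (auto simp: scaleC_complex_def cinner_complex_def algebra_simps scaleR_conv_of_real
      cmod_def power2_eq_square)

end

instantiation prod :: (complex_vector, complex_vector) complex_vector
begin

definition scaleC_prod :: "complex \<Rightarrow> 'a \<times> 'b \<Rightarrow> 'a \<times> 'b"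
  where "scaleC_prod c u = (c *\<^sub>C fst u, c *\<^sub>C snd u)"

instance
  by intro_classes
    (auto simp: scaleC_prod_def prod_eq_iff scaleC_add_right scaleC_add_left scaleC_scaleC
      scaleC_one scaleR_eq_scaleC)

end

lemma cinner_self_of_real: "cinner x x = complex_of_real ((norm (x::'a::complex_inner))\<^sup>2)"
proof -
  have "Im (cinner x x) = 0"
    using arg_cong[OF cinner_commute[of x x], of Im] by simp
  then show ?thesis
    by (simp add: complex_eq_iff norm_eq_sqrt_cinner cinner_ge_zero)
qed

instantiation prod :: (complex_inner, complex_inner) complex_inner
begin

definition cinner_prod :: "'a \<times> 'b \<Rightarrow> 'a \<times> 'b \<Rightarrow> complex"
  where "cinner_prod u v = cinner (fst u) (fst v) + cinner (snd u) (snd v)"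

instance
proof
  fix x y z :: "'a \<times> 'b" and c :: complex
  show "cinner x y = cnj (cinner y x)"
    unfolding cinner_prod_def
    by (metis cinner_commute complex_cnj_add)
  show "cinner (x + y) z = cinner x z + cinner y z"
    by (simp add: cinner_prod_def cinner_add_left)
  show "cinner (c *\<^sub>C x) y = c * cinner x y"
    by (simp add: cinner_prod_def scaleC_prod_def cinner_scaleC_left algebra_simps)
  show "0 \<le> Re (cinner x x)"
    by (simp add: cinner_prod_def cinner_ge_zero)
  have self: "cinner x x = complex_of_real ((norm (fst x))\<^sup>2 + (norm (snd x))\<^sup>2)"
    by (simp add: cinner_prod_def cinner_self_of_real)
  show "cinner x x = 0 \<longleftrightarrow> x = 0"
    unfolding self of_real_eq_0_iff by (simp add: add_nonneg_eq_0_iff prod_eq_iff)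
  show "norm x = sqrt (Re (cinner x x))"
    unfolding self by (simp add: norm_prod_def)
qed

end

instance prod :: (complex_hilbert, complex_hilbert) complex_hilbert ..

definition unitary :: "('a::complex_inner \<Rightarrow> 'a) \<Rightarrow> bool"
  where "unitary U \<longleftrightarrow>
    clinear U \<and> surj U \<and> (\<forall>x y. cinner (U x) (U y) = cinner x y)"

definition positive_operator :: "('a::complex_inner \<Rightarrow> 'a) \<Rightarrow> bool"
  where "positive_operator A \<longleftrightarrow>
    clinear A \<and> bounded_linear A \<and> (\<forall>x. cinner (A x) x \<in> \<real>\<^sub>\<ge>\<^sub>0)"

definition orth_complement :: "'a::complex_inner set \<Rightarrow> 'a set"
  where "orth_complement S = {x. \<forall>y\<in>S. cinner x y = 0}"

definition lorentz_form :: "'h::complex_inner \<times> complex \<Rightarrow> 'h \<times> complex \<Rightarrow> complex"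
  where "lorentz_form u v = cinner (fst u) (fst v) - snd u * cnj (snd v)"

definition lorentz_group :: "('h::complex_inner \<times> complex \<Rightarrow> 'h \<times> complex) set"
  where "lorentz_group =
    {T. clinear T \<and> bij T \<and> (\<forall>u v. lorentz_form (T u) (T v) = lorentz_form u v)}"

definition block_operator ::
    "('h::complex_inner \<Rightarrow> 'h) \<Rightarrow> 'h \<Rightarrow> 'h \<Rightarrow> complex \<Rightarrow> 'h \<times> complex \<Rightarrow> 'h \<times> complex"
  where "block_operator P \<eta> \<zeta> c = (\<lambda>(x, z). (P x + z *\<^sub>C \<eta>, cinner x \<zeta> + c * z))"

definition orthogonal_decomposition :: "'a::complex_inner set \<Rightarrow> 'a set \<Rightarrow> bool"
  where "orthogonal_decomposition V W \<longleftrightarrow>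
    csubspace V \<and> csubspace W \<and> (\<forall>v\<in>V. \<forall>w\<in>W. cinner v w = 0) \<and>
    (\<forall>x. \<exists>v\<in>V. \<exists>w\<in>W. x = v + w)"

text \<open>
  \<open>T = T1 \<oplus> T2\<close> with respect to \<open>V \<oplus> W\<close>. Operators on a subspace are functions that are
  \<open>undefined\<close> outside of it, hence they are compared using \<^const>\<open>restrict\<close>.
\<close>

definition operator_direct_sum ::
    "('a::complex_inner \<Rightarrow> 'a) \<Rightarrow> 'a set \<Rightarrow> 'a set \<Rightarrow> ('a \<Rightarrow> 'a) \<Rightarrow> ('a \<Rightarrow> 'a) \<Rightarrow> bool"
  where "operator_direct_sum T V W T1 T2 \<longleftrightarrow>
    orthogonal_decomposition V W \<and> T ` V \<subseteq> V \<and> T ` W \<subseteq> W \<and>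
    restrict T V = T1 \<and> restrict T W = T2"

end

theory Submission
  imports Defs
begin

text \<open>The first column of T is read off at (0, 1): its image is (U \<xi>, a). If
  \<open>V\<close> = \<langle>\<xi>\<rangle> \<oplus> C is invariant, U \<xi> therefore lies on the
  line through \<xi>, so U \<xi> = r \<xi>, and |r| = 1 because U preserves norms.

  Conversely, let U \<xi> = r \<xi> with |r| = 1. On \<open>V\<close> everything stays on that line,
  since A and U both scale \<xi>. For x orthogonal to \<xi>, A fixes x and the lower left entry of T
  kills it, so T (x, 0) = (U x, 0); and U x is again orthogonal to \<xi>, because a unitary operator
  maps the complement of an eigenvector into itself (\<open>unitary_eigenvector_orth\<close>). That
  \<open>V\<close> and \<open>W\<close> decompose the whole space is projection onto a line
  (\<open>orthogonal_decomposition_cspan_singleton\<close>), with the factor C added to the first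
  summand (\<open>orthogonal_decomposition_Times_UNIV\<close>).\<close>

lemma cinner_zero_left [simp]: "cinner 0 (y::'a::complex_inner) = 0"
  using cinner_add_left[of 0 0 y] by simp

lemma cinner_zero_right [simp]: "cinner (x::'a::complex_inner) 0 = 0"
  using cinner_commute[of x 0] by simp

lemma cinner_diff_left:
  "cinner (x - y) (z::'a::complex_inner) = cinner x z - cinner y z"
  using cinner_add_left[of "x - y" y z] by simp

lemma cinner_scaleC_right: "cinner x (c *\<^sub>C y) = cnj c * cinner (x::'a::complex_inner) y"
  by (metis cinner_commute cinner_scaleC_left complex_cnj_mult)

text \<open>The class axioms state homogeneity of the norm for real scalars only. The complex case
  comes from comparing squared norms, which are inner products.\<close>

lemma norm_scaleC: "norm (c *\<^sub>C x) = cmod c * norm (x::'a::complex_inner)"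
proof -
  have "complex_of_real ((norm (c *\<^sub>C x))\<^sup>2) = c * cnj c * complex_of_real ((norm x)\<^sup>2)"
    by (simp only: cinner_self_of_real[symmetric] cinner_scaleC_left cinner_scaleC_right mult_ac)
  also have "\<dots> = complex_of_real ((cmod c * norm x)\<^sup>2)"
    by (simp only: complex_norm_square[symmetric] power_mult_distrib of_real_mult)
  finally have "(norm (c *\<^sub>C x))\<^sup>2 = (cmod c * norm x)\<^sup>2"
    by (simp only: of_real_eq_iff)
  then show ?thesis
    by simp
qed

lemma cspan_singleton: "cspan {x} = range (\<lambda>k. k *\<^sub>C x)"
  by (rule complex_vector.span_singleton)

lemma csubspace_orth_complement: "csubspace (orth_complement S)"
  by (auto simp: complex_vector.subspace_def orth_complement_def cinner_add_left
      cinner_scaleC_left)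

lemma orth_complement_cspan_singleton:
  "orth_complement (cspan {\<xi>}) = {x. cinner x (\<xi>::'a::complex_inner) = 0}"
proof -
  have "cinner x \<xi> = 0" if "\<forall>k. cinner x (k *\<^sub>C \<xi>) = 0" for x
    using that[rule_format, of 1] by (simp add: scaleC_one)
  then show ?thesis
    by (auto simp: orth_complement_def cspan_singleton cinner_scaleC_right)
qed

lemma csubspace_Times: "csubspace V \<Longrightarrow> csubspace W \<Longrightarrow> csubspace (V \<times> W)"
  by (auto simp: complex_vector.subspace_def scaleC_prod_def zero_prod_def)

lemma orthogonal_decomposition_cspan_singleton:
  "orthogonal_decomposition (cspan {\<xi>}) (orth_complement (cspan {\<xi>::'a::complex_inner}))"
proof -
  have "\<exists>v\<in>cspan {\<xi>}. \<exists>w\<in>orth_complement (cspan {\<xi>}). x = v + w" for x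
  proof (intro bexI)
    \<comment> \<open>The orthogonal projection of x onto the line through \<xi>.\<close>
    let ?v = "(cinner x \<xi> / cinner \<xi> \<xi>) *\<^sub>C \<xi>"
    show "x = ?v + (x - ?v)"
      by simp
    show "x - ?v \<in> orth_complement (cspan {\<xi>})"
      unfolding orth_complement_cspan_singleton
      \<comment> \<open>If \<xi> = 0, the coefficient is 0 / 0 = 0; otherwise pairing
        \<open>?v\<close> with \<xi> gives back \<open>cinner x \<xi>\<close>.\<close>
      by (cases "\<xi> = 0") (simp_all add: cinner_diff_left cinner_scaleC_left cinner_eq_zero_iff)
    show "?v \<in> cspan {\<xi>}"
      by (intro complex_vector.span_scale complex_vector.span_base singletonI)
  qed
  moreover have "cinner v w = 0" if "v \<in> cspan {\<xi>}" "w \<in> orth_complement (cspan {\<xi>})" for v w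
    using that cinner_commute[of v w] by (simp add: orth_complement_def)
  ultimately show ?thesis
    by (simp add: orthogonal_decomposition_def csubspace_orth_complement)
qed

text \<open>The second coordinate of a vector goes entirely to the first summand; this turns a
  splitting of H into one of H \<oplus> C.\<close>

lemma orthogonal_decomposition_Times_UNIV:
  assumes "orthogonal_decomposition V W"
  shows "orthogonal_decomposition (V \<times> (UNIV :: 'b::complex_inner set)) (W \<times> {0})"
proof -
  have "csubspace (UNIV :: 'b set)" "csubspace {0 :: 'b}"
    by simp_all
  moreover have "\<exists>v\<in>V \<times> UNIV. \<exists>w\<in>W \<times> {0}. x = v + w" for x :: "'a \<times> 'b"
  proof -
    obtain v w where "v \<in> V" "w \<in> W" "fst x = v + w"
      using assms unfolding orthogonal_decomposition_def by blast
    then show ?thesis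
      by (intro bexI[of _ "(v, snd x)"] bexI[of _ "(w, 0)"]) (auto simp: prod_eq_iff)
  qed
  ultimately show ?thesis
    using assms unfolding orthogonal_decomposition_def
    by (auto simp: csubspace_Times cinner_prod_def)
qed

lemma clinear_zero: "clinear f \<Longrightarrow> f 0 = 0"
  by (rule module_hom.zero[OF module_hom_linearI])

lemma clinear_scaleC: "clinear f \<Longrightarrow> f (c *\<^sub>C x) = c *\<^sub>C f x"
  by (rule module_hom.scale[OF module_hom_linearI])

lemma unitary_scaleC: "unitary U \<Longrightarrow> U (c *\<^sub>C x) = c *\<^sub>C U x"
  by (simp add: unitary_def clinear_scaleC)

lemma unitary_norm: "unitary U \<Longrightarrow> norm (U x) = norm x"
  by (simp add: unitary_def norm_eq_sqrt_cinner)

text \<open>Replacing \<xi> by U \<xi> only multiplies the inner product by the conjugate of r, and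
  U preserves inner products; then r cancels.\<close>

lemma unitary_eigenvector_orth:
  assumes "unitary U" "U \<xi> = r *\<^sub>C \<xi>" "r \<noteq> 0" "cinner x \<xi> = 0"
  shows "cinner (U x) \<xi> = 0"
proof -
  have "cnj r * cinner (U x) \<xi> = cinner (U x) (U \<xi>)"
    by (simp add: assms(2) cinner_scaleC_right)
  also have "\<dots> = 0"
    using assms(1,4) by (simp add: unitary_def)
  finally show ?thesis
    using \<open>r \<noteq> 0\<close> by simp
qed

theorem proposition3p3:
  fixes \<xi> :: "'h::complex_hilbert"
    and U A :: "'h \<Rightarrow> 'h"
    and a :: real
    and T :: "'h \<times> complex \<Rightarrow> 'h \<times> complex"
    and V W :: "('h \<times> complex) set"
  assumes infinite_dim: "\<not> (\<exists>B. finite B \<and> cspan B = (UNIV :: 'h set))"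
    and "\<xi> \<noteq> 0"
    and "unitary U"
    and "a = sqrt (1 + (norm \<xi>)\<^sup>2)"
    and "positive_operator A"
    and "A \<xi> = complex_of_real a *\<^sub>C \<xi>"
    and "\<forall>x \<in> orth_complement (cspan {\<xi>}). A x = x"
    and "T = block_operator (U \<circ> A) (U \<xi>) \<xi> (complex_of_real a)"
    and "T \<in> lorentz_group"
    and "V = cspan {\<xi>} \<times> UNIV"
    and "W = orth_complement (cspan {\<xi>}) \<times> {0}"
  shows "operator_direct_sum T V W (restrict T V) (restrict (\<lambda>(x, z). (U x, z)) W)
    \<longleftrightarrow> (\<exists>r::complex. cmod r = 1 \<and> U \<xi> = r *\<^sub>C \<xi>)"
proof -
  have T: "T (x, z) = (U (A x) + z *\<^sub>C U \<xi>, cinner x \<xi> + complex_of_real a * z)" for x z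
    by (simp add: \<open>T = _\<close> block_operator_def)
  have "clinear A"
    using \<open>positive_operator A\<close> by (simp add: positive_operator_def)
  have W: "W = {x. cinner x \<xi> = 0} \<times> {0}"
    by (simp add: \<open>W = _\<close> orth_complement_cspan_singleton)
  \<comment> \<open>On \<open>W\<close> the operator A is the identity and both entries of the
    second row contribute 0.\<close>
  have TW: "T (x, 0) = (U x, 0)" if "cinner x \<xi> = 0" for x
    using that \<open>\<forall>x \<in> _. A x = x\<close>
    by (simp add: T orth_complement_cspan_singleton)
  show ?thesis
  proof
    assume "operator_direct_sum T V W (restrict T V) (restrict (\<lambda>(x, z). (U x, z)) W)"
    then have "T ` V \<subseteq> V"
      by (simp add: operator_direct_sum_def)
    \<comment> \<open>This vector is chosen because the first component of its image is U
      \<xi>.\<close>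
    moreover have "(0, 1) \<in> V"
      by (simp add: \<open>V = _\<close> complex_vector.span_zero)
    ultimately have "T (0, 1) \<in> V"
      by blast
    moreover have "A 0 = 0" "U 0 = 0"
      using \<open>clinear A\<close> \<open>unitary U\<close> by (simp_all add: unitary_def clinear_zero)
    ultimately have "U \<xi> \<in> cspan {\<xi>}"
      by (simp add: T \<open>V = _\<close> scaleC_one)
    then obtain r where r: "U \<xi> = r *\<^sub>C \<xi>"
      by (auto simp: cspan_singleton)
    then have "cmod r = 1"
      using unitary_norm[OF \<open>unitary U\<close>, of \<xi>] \<open>\<xi> \<noteq> 0\<close> by (simp add: norm_scaleC)
    with r show "\<exists>r. cmod r = 1 \<and> U \<xi> = r *\<^sub>C \<xi>"
      by blast
  next
    assume "\<exists>r. cmod r = 1 \<and> U \<xi> = r *\<^sub>C \<xi>"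
    then obtain r where "cmod r = 1" and r: "U \<xi> = r *\<^sub>C \<xi>"
      by blast
    then have "r \<noteq> 0"
      by auto
    \<comment> \<open>The first component of the image is (k a + z) r \<xi>; the second is
      unrestricted in \<open>V\<close>.\<close>
    have "T (k *\<^sub>C \<xi>, z) \<in> V" for k and z :: complex
      using \<open>clinear A\<close> \<open>A \<xi> = _\<close> \<open>unitary U\<close>
      by (simp add: T \<open>V = _\<close> r unitary_scaleC clinear_scaleC
          complex_vector.span_base complex_vector.span_scale complex_vector.span_add)
    moreover have "\<exists>k z. v = (k *\<^sub>C \<xi>, z)" if "v \<in> V" for v
      using that by (auto simp: \<open>V = _\<close> cspan_singleton)
    ultimately have "T ` V \<subseteq> V"
      by blast
    moreover have "T ` W \<subseteq> W"
      using unitary_eigenvector_orth[OF \<open>unitary U\<close> r \<open>r \<noteq> 0\<close>] by (auto simp: W TW)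
    \<comment> \<open>The second coordinate is 0 throughout \<open>W\<close>, so the right-hand side
      is U under the identification of x with (x, 0).\<close>
    moreover have "restrict T W = restrict (\<lambda>(x, z). (U x, z)) W"
      by (rule restrict_ext) (auto simp: W TW)
    moreover have "orthogonal_decomposition V W"
      unfolding \<open>V = _\<close> \<open>W = orth_complement _ \<times> _\<close>
      by (intro orthogonal_decomposition_Times_UNIV orthogonal_decomposition_cspan_singleton)
    ultimately show "operator_direct_sum T V W (restrict T V) (restrict (\<lambda>(x, z). (U x, z)) W)"
      by (simp add: operator_direct_sum_def)
  qed
qed

end
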